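(* Let $G$ be a finitely generated abelian-by-finite group, and let $A$ be a torsion-free abelian normal subgroup of $G$ of finite index. If $G^{ab}=G/G'$ is finite, then $G\in\widehat{\mathcal{B}}_n$, where $n=\exp(G/A)\cdot|G/A|$.
   Context: For elements $x,y$ of a group, $x^y=y^{-1}xy$. For a positive integer $n$, $\widehat{\mathcal{B}}_n$ denotes the class of all groups $G$ satisfying a positive generalized identity of degree $n$, i.e. for which there exist fixed elements $x_1,\dots,x_n\in G$ such that $g^{x_1}g^{x_2}\cdots g^{x_n}=1$ for all $g\in G$. $\exp(H)$ denotes the usual exponent of a group $H$. A group is abelian-by-finite if it has an abelian normal subgroup of finite index. *)

theory Defs
  imports "HOL-Algebra.Algebra"
begin

definition conjugate :: "('a, 'b) monoid_scheme \<Rightarrow> 'a \<Rightarrow> 'a \<Rightarrow> 'a" where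
  "conjugate G g x = inv\<^bsub>G\<^esub> x \<otimes>\<^bsub>G\<^esub> g \<otimes>\<^bsub>G\<^esub> x"

text \<open>
  The class of all groups with a positive generalized identity of degree \<open>n\<close>; it is only
  meant for \<open>n > 0\<close> and is empty for \<open>n = 0\<close>. The list \<open>xs\<close> holds the constants
  \<open>x\<^sub>1, \<dots>, x\<^sub>n\<close> (in this order, repetitions allowed).
\<close>
definition pos_gen_identity_class :: "nat \<Rightarrow> ('a, 'b) monoid_scheme set" where
  "pos_gen_identity_class n =
     {G. group G \<and> n > 0 \<and>
         (\<exists>xs. length xs = n \<and> set xs \<subseteq> carrier G \<and>
            (\<forall>g\<in>carrier G. foldr (\<otimes>\<^bsub>G\<^esub>) (map (conjugate G g) xs) \<one>\<^bsub>G\<^esub> = \<one>\<^bsub>G\<^esub>))}"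

text \<open>The exponent is \<open>0\<close> if no positive power annihilates the whole group.\<close>
definition group_exponent :: "('a, 'b) monoid_scheme \<Rightarrow> nat" where
  "group_exponent H =
     (if \<exists>k::nat. k > 0 \<and> (\<forall>x\<in>carrier H. x [^]\<^bsub>H\<^esub> k = \<one>\<^bsub>H\<^esub>)
      then LEAST k::nat. k > 0 \<and> (\<forall>x\<in>carrier H. x [^]\<^bsub>H\<^esub> k = \<one>\<^bsub>H\<^esub>) else 0)"

definition finitely_generated_group :: "('a, 'b) monoid_scheme \<Rightarrow> bool" where
  "finitely_generated_group G \<longleftrightarrow>
     group G \<and> (\<exists>S. finite S \<and> S \<subseteq> carrier G \<and> generate G S = carrier G)"

definition torsion_free_group :: "('a, 'b) monoid_scheme \<Rightarrow> bool" where
  "torsion_free_group H \<longleftrightarrow>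
     group H \<and> (\<forall>x\<in>carrier H. \<forall>k::nat. k > 0 \<longrightarrow> x [^]\<^bsub>H\<^esub> k = \<one>\<^bsub>H\<^esub> \<longrightarrow> x = \<one>\<^bsub>H\<^esub>)"

definition abelian_by_finite :: "('a, 'b) monoid_scheme \<Rightarrow> bool" where
  "abelian_by_finite G \<longleftrightarrow>
     group G \<and> (\<exists>N. N \<lhd> G \<and> comm_group (G\<lparr>carrier := N\<rparr>) \<and> finite (carrier (G Mod N)))"

definition abelianization :: "('a, 'b) monoid_scheme \<Rightarrow> 'a set monoid" where
  "abelianization G = G Mod (derived G (carrier G))"

end

theory Submission
  imports Defs
begin

text \<open>
  Let \<open>V\<close> be the transfer from \<open>G\<close> to \<open>A\<close>. It is a homomorphism from a group with finite
  abelianization to a torsion-free abelian group, hence trivial. On \<open>a \<in> A\<close> it equals the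
  product of \<open>t a t\<^sup>-\<^sup>1\<close> over coset representatives \<open>t\<close> of \<open>A\<close>. With \<open>e = exp(G/A)\<close> and
  \<open>a = g\<^sup>e \<in> A\<close>, this says that the product of the \<open>(t g t\<^sup>-\<^sup>1)\<^sup>e\<close> is trivial, which is a
  positive generalized identity of degree \<open>e \<cdot> |G/A|\<close>.
\<close>

section \<open>The transfer to an abelian subgroup and its vanishing\<close>

definition coset_rep :: "'a set \<Rightarrow> 'a" where
  "coset_rep C = (SOME x. x \<in> C)"

text \<open>\<open>finprod\<close> is taken in the restricted structure because only
  \<open>H\<close>, not \<open>G\<close>, is commutative. For infinite index it defaults to the
  unit.\<close>

definition abelian_transfer :: "('a, 'b) monoid_scheme \<Rightarrow> 'a set \<Rightarrow> 'a \<Rightarrow> 'a" where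
  "abelian_transfer G H g =
     (\<Otimes>\<^bsub>G\<lparr>carrier := H\<rparr>\<^esub>C\<in>rcosets\<^bsub>G\<^esub> H.
        coset_rep C \<otimes>\<^bsub>G\<^esub> g \<otimes>\<^bsub>G\<^esub> inv\<^bsub>G\<^esub> coset_rep (C #>\<^bsub>G\<^esub> g))"

context group
begin

lemma coset_rep_mem:
  assumes "subgroup H G" "C \<in> rcosets H"
  shows "coset_rep C \<in> C"
proof -
  from assms obtain x where "x \<in> carrier G" "C = H #> x"
    unfolding RCOSETS_def by blast
  then have "x \<in> C" using rcos_self assms(1) by blast
  then show ?thesis unfolding coset_rep_def by (rule someI)
qed

lemma coset_rep_closed:
  assumes "subgroup H G" "C \<in> rcosets H"
  shows "coset_rep C \<in> carrier G"
  using coset_rep_mem[OF assms] subgroup.rcosets_carrier[OF assms(1) is_group assms(2)] by blast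

lemma r_coset_coset_rep:
  assumes "subgroup H G" "C \<in> rcosets H"
  shows "H #> coset_rep C = C"
proof -
  from assms obtain x where x: "x \<in> carrier G" "C = H #> x"
    unfolding RCOSETS_def by blast
  then show ?thesis using repr_independence coset_rep_mem[OF assms] assms(1) by metis
qed

lemma rcosets_r_mult:
  assumes "subgroup H G" "C \<in> rcosets H" "g \<in> carrier G"
  shows "C #> g \<in> rcosets H"
proof -
  from assms obtain x where x: "x \<in> carrier G" "C = H #> x"
    unfolding RCOSETS_def by blast
  then show ?thesis
    using assms by (simp add: coset_mult_assoc subgroup.subset rcosetsI)
qed

lemma bij_betw_rcosets_r_mult:
  assumes "subgroup H G" "g \<in> carrier G"
  shows "bij_betw (\<lambda>C. C #> g) (rcosets H) (rcosets H)"
proof (rule bij_betw_byWitness[where f' = "\<lambda>C. C #> inv g"])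
  have sub: "C \<subseteq> carrier G" if "C \<in> rcosets H" for C
    using subgroup.rcosets_carrier[OF assms(1) is_group that] .
  show "\<forall>C\<in>rcosets H. C #> g #> inv g = C" "\<forall>C\<in>rcosets H. C #> inv g #> g = C"
    using assms sub by (simp_all add: coset_mult_assoc)
  show "(\<lambda>C. C #> g) ` (rcosets H) \<subseteq> rcosets H" "(\<lambda>C. C #> inv g) ` (rcosets H) \<subseteq> rcosets H"
    using assms rcosets_r_mult by auto
qed

text \<open>Both \<open>coset_rep C \<otimes> g\<close> and \<open>coset_rep (C #> g)\<close>
  represent the coset \<open>C #> g\<close>, so they differ by a left factor from
  \<open>H\<close>.\<close>

lemma transfer_factor_mem:
  assumes "subgroup H G" "C \<in> rcosets H" "g \<in> carrier G"
  shows "coset_rep C \<otimes> g \<otimes> inv coset_rep (C #> g) \<in> H"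
proof -
  let ?x = "coset_rep C" and ?y = "coset_rep (C #> g)"
  have x: "?x \<in> carrier G" using coset_rep_closed assms by blast
  have D: "C #> g \<in> rcosets H" using rcosets_r_mult assms by blast
  have y: "?y \<in> carrier G" using coset_rep_closed assms(1) D by blast
  have "H #> ?y = H #> (?x \<otimes> g)"
    using r_coset_coset_rep[OF assms(1) D] r_coset_coset_rep[OF assms(1,2)]
      coset_mult_assoc[OF subgroup.subset[OF assms(1)] x assms(3)] by simp
  then have "?x \<otimes> g \<in> H #> ?y"
    using rcos_self assms x by simp
  then obtain h where h: "h \<in> H" "?x \<otimes> g = h \<otimes> ?y"
    unfolding r_coset_def by blast
  then have "?x \<otimes> g \<otimes> inv ?y = h"
    using y subgroup.mem_carrier[OF assms(1)] by (simp add: m_assoc)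
  with h show ?thesis by simp
qed

text \<open>The factor of a product \<open>g \<otimes> h\<close> at \<open>C\<close> splits into the
  factor of \<open>g\<close> at \<open>C\<close> and that of \<open>h\<close> at
  \<open>C #> g\<close>. Commutativity of \<open>H\<close> separates the two products, and since
  \<open>C \<mapsto> C #> g\<close> permutes the cosets, the second one is the transfer of
  \<open>h\<close>.\<close>

lemma abelian_transfer_hom:
  assumes H: "subgroup H G" and comm: "comm_group (G\<lparr>carrier := H\<rparr>)"
  shows "abelian_transfer G H \<in> hom G (G\<lparr>carrier := H\<rparr>)"
proof -
  interpret A: comm_group "G\<lparr>carrier := H\<rparr>" by (rule comm)
  define f where "f = (\<lambda>g C. coset_rep C \<otimes> g \<otimes> inv coset_rep (C #> g))"
  have f: "f g C \<in> H" if "C \<in> rcosets H" "g \<in> carrier G" for g C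
    using transfer_factor_mem[OF H that] by (simp add: f_def)
  have tr: "abelian_transfer G H g = finprod (G\<lparr>carrier := H\<rparr>) (f g) (rcosets H)" for g
    by (simp add: abelian_transfer_def f_def)
  have "abelian_transfer G H (g \<otimes> h) = abelian_transfer G H g \<otimes> abelian_transfer G H h"
    if g: "g \<in> carrier G" and h: "h \<in> carrier G" for g h
  proof -
    have bij: "bij_betw (\<lambda>C. C #> g) (rcosets H) (rcosets H)"
      using bij_betw_rcosets_r_mult[OF H g] .
    have split: "f (g \<otimes> h) C = f g C \<otimes> f h (C #> g)" if C: "C \<in> rcosets H" for C
    proof -
      have D: "C #> g \<in> rcosets H" "C #> g #> h \<in> rcosets H"
        using rcosets_r_mult H C g h by blast+
      have "C #> (g \<otimes> h) = C #> g #> h"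
        using coset_mult_assoc[OF subgroup.rcosets_carrier[OF H is_group C] g h] by simp
      moreover have "coset_rep C \<in> carrier G" "coset_rep (C #> g) \<in> carrier G"
        "coset_rep (C #> g #> h) \<in> carrier G"
        using coset_rep_closed H C D by blast+
      \<comment> \<open>The representative of the intermediate coset \<open>C #> g\<close> cancels.
        The right-nested form is the one to which \<open>m_assoc\<close> brings the goal.\<close>
      moreover from this have "inv coset_rep (C #> g) \<otimes> (coset_rep (C #> g) \<otimes> (h \<otimes> inv coset_rep (C #> g #> h)))
        = h \<otimes> inv coset_rep (C #> g #> h)"
        using h by (simp add: m_assoc[symmetric])
      ultimately show ?thesis using g h by (simp add: f_def m_assoc)
    qed
    have "abelian_transfer G H (g \<otimes> h) =
        finprod (G\<lparr>carrier := H\<rparr>) (\<lambda>C. f g C \<otimes>\<^bsub>G\<lparr>carrier := H\<rparr>\<^esub> f h (C #> g)) (rcosets H)"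
      unfolding tr
      by (rule A.finprod_cong') (use split f g h rcosets_r_mult[OF H] in \<open>auto intro!: subgroup.m_closed[OF H]\<close>)
    also have "\<dots> = finprod (G\<lparr>carrier := H\<rparr>) (f g) (rcosets H) \<otimes>
        finprod (G\<lparr>carrier := H\<rparr>) (\<lambda>C. f h (C #> g)) (rcosets H)"
      by (subst A.finprod_multf) (use f g h rcosets_r_mult[OF H] in auto)
    also have "finprod (G\<lparr>carrier := H\<rparr>) (\<lambda>C. f h (C #> g)) (rcosets H) =
        finprod (G\<lparr>carrier := H\<rparr>) (f h) ((\<lambda>C. C #> g) ` (rcosets H))"
      by (rule A.finprod_reindex[symmetric])
        (use f h rcosets_r_mult[OF H _ g] bij in \<open>auto simp: bij_betw_def\<close>)
    finally show ?thesis using bij by (simp add: tr bij_betw_def)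
  qed
  moreover have "abelian_transfer G H g \<in> H" if "g \<in> carrier G" for g
    using A.finprod_closed[of "f g" "rcosets H"] f that by (auto simp: tr)
  ultimately show ?thesis by (simp add: hom_def)
qed

text \<open>As \<open>K\<close> is abelian, \<open>h\<close> kills the derived subgroup. With m the
  order of the abelianization, the m-th power of \<open>g\<close> lies there, so \<open>h g\<close>
  has trivial m-th power and torsion-freeness applies.\<close>

lemma hom_torsion_free_trivial:
  assumes fin: "finite (carrier (abelianization G))"
    and comm: "comm_group K" and tf: "torsion_free_group K"
    and hom: "h \<in> hom G K" and g: "g \<in> carrier G"
  shows "h g = \<one>\<^bsub>K\<^esub>"
proof -
  interpret K: comm_group K by (rule comm)
  interpret h: group_hom G K h
    by (simp add: group_hom_def group_hom_axioms_def hom K.is_group)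
  let ?D = "derived G (carrier G)"
  interpret D: normal ?D G
    by (rule derived_is_normal) (simp add: normal_self)
  interpret Q: group "G Mod ?D" by (rule D.factorgroup_is_group)
  have "?D #> g \<in> carrier (G Mod ?D)"
    using g by (simp add: carrier_FactGroup)
  then have "(?D #> g) [^]\<^bsub>G Mod ?D\<^esub> order (G Mod ?D) = \<one>\<^bsub>G Mod ?D\<^esub>"
    by (rule Q.pow_order_eq_1)
  then have "?D #> (g [^] order (G Mod ?D)) = ?D"
    using hom_nat_pow[OF D.r_coset_hom_Mod g is_group Q.is_group] by simp
  then have mem: "g [^] order (G Mod ?D) \<in> ?D"
    using g rcos_self[OF _ D.subgroup_axioms] by (metis nat_pow_closed)
  have "h ` ?D = {\<one>\<^bsub>K\<^esub>}"
    using h.derived_img[of "carrier G"] K.derived_eq_singleton[of "h ` carrier G"] h.hom_closed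
    by (metis image_subsetI subset_refl)
  with mem have "h g [^]\<^bsub>K\<^esub> order (G Mod ?D) = \<one>\<^bsub>K\<^esub>"
    using h.hom_nat_pow[OF g] by (metis imageI singletonD)
  \<comment> \<open>\<open>order\<close> is 0 for an infinite carrier, so finiteness of the
    abelianization supplies the positive exponent that torsion-freeness asks for.\<close>
  moreover have "order (G Mod ?D) > 0"
    using fin Q.order_gt_0_iff_finite by (simp add: abelianization_def)
  ultimately show ?thesis
    using tf g unfolding torsion_free_group_def by auto
qed

end

text \<open>Writing x for a representative, x a = (x a x^-1) x with x a x^-1 in \<open>H\<close> by
  normality. Hence \<open>a\<close> fixes every right coset, and both representatives in each
  transfer factor coincide.\<close>

lemma (in normal) abelian_transfer_eq:
  assumes comm: "comm_group (G\<lparr>carrier := H\<rparr>)" and a: "a \<in> H"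
  shows "abelian_transfer G H a =
    (\<Otimes>\<^bsub>G\<lparr>carrier := H\<rparr>\<^esub>C\<in>rcosets H. coset_rep C \<otimes> a \<otimes> inv coset_rep C)"
proof -
  interpret A: comm_group "G\<lparr>carrier := H\<rparr>" by (rule comm)
  have "C #> a = C" if C: "C \<in> rcosets H" for C
  proof -
    let ?x = "coset_rep C"
    have x: "?x \<in> carrier G" using coset_rep_closed[OF subgroup_axioms C] .
    have "C #> a = H #> (?x \<otimes> a)"
      using coset_mult_assoc[OF subset x mem_carrier[OF a]] r_coset_coset_rep[OF subgroup_axioms C]
      by simp
    also have "?x \<otimes> a = (?x \<otimes> a \<otimes> inv ?x) \<otimes> ?x"
      using x a mem_carrier by (simp add: m_assoc)
    also have "H #> \<dots> = H #> (?x \<otimes> a \<otimes> inv ?x) #> ?x"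
      using x a mem_carrier subset by (simp add: coset_mult_assoc)
    also have "\<dots> = C"
      using coset_join2[OF _ subgroup_axioms inv_op_closed2[OF x a]] x a mem_carrier
        r_coset_coset_rep[OF subgroup_axioms C] by simp
    finally show ?thesis .
  qed
  then show ?thesis
    unfolding abelian_transfer_def
    by (intro A.finprod_cong')
      (use coset_rep_closed[OF subgroup_axioms] inv_op_closed2[OF _ a] in auto)
qed

section \<open>The exponent of a finite group\<close>

lemma group_exponent_finite:
  assumes "group K" "finite (carrier K)"
  shows "group_exponent K > 0"
    and "\<And>x. x \<in> carrier K \<Longrightarrow> x [^]\<^bsub>K\<^esub> group_exponent K = \<one>\<^bsub>K\<^esub>"
proof -
  interpret group K by fact
  let ?P = "\<lambda>k::nat. k > 0 \<and> (\<forall>x\<in>carrier K. x [^]\<^bsub>K\<^esub> k = \<one>\<^bsub>K\<^esub>)"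
  \<comment> \<open>By Lagrange the order is a positive annihilating exponent, so the default value
    0 is excluded and the \<open>LEAST\<close> is attained.\<close>
  have ex: "?P (order K)"
    using order_gt_0_iff_finite assms(2) pow_order_eq_1 by auto
  then have "group_exponent K = (LEAST k. ?P k)"
    unfolding group_exponent_def by (subst if_P) blast+
  with LeastI[of ?P, OF ex]
  show "group_exponent K > 0" "\<And>x. x \<in> carrier K \<Longrightarrow> x [^]\<^bsub>K\<^esub> group_exponent K = \<one>\<^bsub>K\<^esub>"
    by auto
qed

section \<open>Ordered products of conjugates\<close>

context group
begin

lemma foldr_mult_closed:
  "set xs \<subseteq> carrier G \<Longrightarrow> foldr (\<otimes>) xs \<one> \<in> carrier G"
  by (induction xs) auto

text \<open>Folding over \<open>replicate n x\<close> produces this iterate; the lemma turns it into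
  a power.\<close>

lemma funpow_mult_eq:
  assumes "x \<in> carrier G" "y \<in> carrier G"
  shows "((\<otimes>) x ^^ n) y = x [^] n \<otimes> y"
proof (induction n)
  case (Suc n)
  have "((\<otimes>) x ^^ Suc n) y = x \<otimes> x [^] n \<otimes> y"
    using Suc assms by (simp add: m_assoc)
  \<comment> \<open>\<open>nat_pow_Suc\<close> splits off the last factor, whereas here the first
    one is needed.\<close>
  also have "x \<otimes> x [^] n = x [^] Suc n"
    using assms(1) by (simp only: nat_pow_Suc2)
  finally show ?case .
qed (use assms in simp)

lemma conjugate_closed:
  "g \<in> carrier G \<Longrightarrow> x \<in> carrier G \<Longrightarrow> conjugate G g x \<in> carrier G"
  by (simp add: conjugate_def)

lemma conjugate_nat_pow:
  assumes "g \<in> carrier G" "x \<in> carrier G"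
  shows "conjugate G g x [^] (n::nat) = conjugate G (g [^] n) x"
proof (induction n)
  case (Suc n)
  \<comment> \<open>Between adjacent conjugates \<open>x\<close> and \<open>inv x\<close>
    cancel.\<close>
  have "x \<otimes> (inv x \<otimes> (g \<otimes> x)) = g \<otimes> x"
    using assms by (simp add: m_assoc[symmetric])
  with Suc assms show ?case by (simp add: conjugate_def m_assoc)
qed (use assms in \<open>simp add: conjugate_def\<close>)

text \<open>A block of \<open>n\<close> copies of a constant t contributes the \<open>n\<close>-th
  power of the conjugate of \<open>g\<close> by t, which is the conjugate of \<open>g [^] n\<close>.
  Repeating constants thus reduces an identity for \<open>g\<close> to one for its power, at the
  cost of multiplying the degree by \<open>n\<close>.\<close>

lemma foldr_conjugate_replicate:
  assumes "g \<in> carrier G" "set ts \<subseteq> carrier G"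
  shows "foldr (\<otimes>) (map (conjugate G g) (concat (map (replicate n) ts))) \<one> =
    foldr (\<otimes>) (map (conjugate G (g [^] n)) ts) \<one>"
  using assms(2)
proof (induction ts)
  case (Cons t ts)
  have "set (map (conjugate G g) (concat (map (replicate n) ts))) \<subseteq> carrier G"
    using Cons.prems assms(1) conjugate_closed by auto
  from foldr_mult_closed[OF this] Cons assms(1) show ?case
    by (simp add: funpow_mult_eq conjugate_closed conjugate_nat_pow)
qed simp

text \<open>Links the ordered product in the definition of a generalized identity to the unordered
  product in the transfer. Distinctness makes each index count once, as in a product over a
  set.\<close>

lemma foldr_mult_eq_finprod:
  assumes "comm_group (G\<lparr>carrier := H\<rparr>)" "distinct Cs" "f \<in> set Cs \<rightarrow> H"
  shows "foldr (\<otimes>) (map f Cs) \<one> = finprod (G\<lparr>carrier := H\<rparr>) f (set Cs)"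
proof -
  interpret A: comm_group "G\<lparr>carrier := H\<rparr>" by fact
  show ?thesis
    using assms(2,3) by (induction Cs) auto
qed

end

section \<open>The positive generalized identity obtained from the transfer\<close>

theorem corollary4p1:
  fixes G :: "('a, 'b) monoid_scheme" and A :: "'a set"
  assumes "group G"
    and "finitely_generated_group G"
    and "abelian_by_finite G"
    and "A \<lhd> G"
    and "comm_group (G\<lparr>carrier := A\<rparr>)"
    and "torsion_free_group (G\<lparr>carrier := A\<rparr>)"
    and "finite (carrier (G Mod A))"
    and "finite (carrier (abelianization G))"
  shows "G \<in> pos_gen_identity_class (group_exponent (G Mod A) * order (G Mod A))"
proof -
  interpret normal A G by fact
  interpret Q: group "G Mod A" by (rule factorgroup_is_group)
  let ?e = "group_exponent (G Mod A)"
  have car: "carrier (G Mod A) = rcosets\<^bsub>G\<^esub> A" by (simp add: FactGroup_def)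
  obtain Cs where Cs: "set Cs = rcosets\<^bsub>G\<^esub> A" "distinct Cs"
    using finite_distinct_list assms(7) car by metis
  \<comment> \<open>Inverses are taken because \<open>conjugate G g x\<close> has
    \<open>inv x\<close> on the left, while the transfer has the representative there.\<close>
  define ts where "ts = map (\<lambda>C. inv\<^bsub>G\<^esub> coset_rep C) Cs"
  have ts: "set ts \<subseteq> carrier G"
    using Cs coset_rep_closed[OF subgroup_axioms] by (auto simp: ts_def)
  have len: "length ts = order (G Mod A)"
    using Cs distinct_card by (fastforce simp: ts_def order_def car)
  \<comment> \<open>The constants are the inverse representatives, each repeated \<open>?e\<close>
    times.\<close>
  have "foldr (\<otimes>\<^bsub>G\<^esub>) (map (conjugate G g) (concat (map (replicate ?e) ts))) \<one>\<^bsub>G\<^esub> = \<one>\<^bsub>G\<^esub>"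
    if g: "g \<in> carrier G" for g
  proof -
    let ?a = "g [^]\<^bsub>G\<^esub> ?e"
    have "A #>\<^bsub>G\<^esub> g \<in> carrier (G Mod A)"
      using g by (simp add: carrier_FactGroup)
    \<comment> \<open>The exponent of the quotient kills the coset of \<open>g\<close>. This puts
      \<open>?a\<close> into \<open>A\<close>, where the transfer is a product of
      conjugates.\<close>
    then have "A #>\<^bsub>G\<^esub> ?a = A"
      using group_exponent_finite(2)[OF Q.is_group assms(7)] g
        hom_nat_pow[OF r_coset_hom_Mod g is_group Q.is_group] by simp
    then have a: "?a \<in> A"
      using g rcos_self[OF _ subgroup_axioms] by (metis nat_pow_closed)
    have "map (conjugate G ?a) ts =
        map (\<lambda>C. coset_rep C \<otimes>\<^bsub>G\<^esub> ?a \<otimes>\<^bsub>G\<^esub> inv\<^bsub>G\<^esub> coset_rep C) Cs"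
      using coset_rep_closed[OF subgroup_axioms] Cs by (simp add: ts_def conjugate_def)
    then have "foldr (\<otimes>\<^bsub>G\<^esub>) (map (conjugate G g) (concat (map (replicate ?e) ts))) \<one>\<^bsub>G\<^esub> =
        foldr (\<otimes>\<^bsub>G\<^esub>) (map (\<lambda>C. coset_rep C \<otimes>\<^bsub>G\<^esub> ?a \<otimes>\<^bsub>G\<^esub> inv\<^bsub>G\<^esub> coset_rep C) Cs) \<one>\<^bsub>G\<^esub>"
      using foldr_conjugate_replicate[OF g ts] by simp
    also have "\<dots> = abelian_transfer G A ?a"
      unfolding abelian_transfer_eq[OF assms(5) a] Cs(1)[symmetric]
      by (rule foldr_mult_eq_finprod[OF assms(5) Cs(2)])
        (use Cs coset_rep_closed[OF subgroup_axioms] inv_op_closed2[OF _ a] in auto)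
    also have "\<dots> = \<one>\<^bsub>G\<^esub>"
      using hom_torsion_free_trivial[OF assms(8,5,6)
          abelian_transfer_hom[OF subgroup_axioms assms(5)]] g by simp
    finally show ?thesis .
  qed
  moreover have "length (concat (map (replicate ?e) ts)) = ?e * order (G Mod A)"
    using len by (simp add: length_concat comp_def sum_list_triv)
  moreover have "set (concat (map (replicate ?e) ts)) \<subseteq> carrier G"
    using ts by auto
  \<comment> \<open>The class is empty in degree 0; finiteness of the quotient makes both factors
    positive.\<close>
  moreover have "?e * order (G Mod A) > 0"
    using group_exponent_finite(1)[OF Q.is_group assms(7)] Q.order_gt_0_iff_finite assms(7) by simp
  ultimately show ?thesis
    unfolding pos_gen_identity_class_def using assms(1) by blast
qed

end
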